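(* Let $Y_1$, $Z$, $\mu_{\rm in}$, $d_0$, $\mathfrak L$ be produced by the cellular joint construction described in the context. Then: (P1) $M(Y_1)\ge\mathfrak L^{-1}M(Y)$. (P2) If $x\in Y_1(T)$ and $T\in\mathcal T_B$, then $x\in Z(B)$. (P3) For every $B$, on $U(\mathcal T_B,Y_1)$ one has $\mu_{\rm in}\le\sum_{T\in\mathcal T_B}\mathbf 1_{Y_1(T)}(x)<2\mu_{\rm in}$. (P4) On $\bigcup_BZ(B)$ one has $d_0\le\sum_B\mathbf 1_{Z(B)}(x)<2d_0$. (P5) At every child point $x\in U(\mathcal T,Y_1)$, $\sum_{T\in\mathcal T}\mathbf 1_{Y_1(T)}(x)<4\mu_{\rm in}d_0$. Moreover $Z(B)$ is contained in the labelled fixed enlargement $\widetilde B$, which has the same side-length scales as $B$.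
   Context: Families are finite and labelled (coincident carriers with different labels are distinct; sums count labels). $|\cdot|$ is Lebesgue measure in $\mathbb R^3$; $U(\mathcal F,Y)=\bigcup_{F\in\mathcal F}Y(F)$. Setting. Let $0<a\le b\le r$, $0<c_0\le10^{-3}$, $h=c_0a$, $\mathcal Q_h=\{h(k+[0,1)^3):k\in\mathbb Z^3\}$. $\mathcal B$ is a finite nonempty labelled family of parents; the label $B$ carries an arbitrarily oriented $a\times b\times r$ rectangular box $B^\sharp$ and its enlargement $\widetilde B$, the concentric box with the same axes and half-side lengths $\frac a2+\sqrt3h,\frac b2+\sqrt3h,\frac r2+\sqrt3h$. $\mathcal T=\bigsqcup_{B\in\mathcal B}\mathcal T_B$ is a finite indexed family; every $T\in\mathcal T_B$ is contained in $B^\sharp$ and has a measurable shading $Y(T)\subset T$. Put $M(Y)=\sum_B\sum_{T\in\mathcal T_B}|Y(T)|$ and assume $0<M(Y)<\infty$. Let $N_{\max}=\max_B|\mathcal T_B|$. Construction. (1) With $f_B(x)=\sum_{T\in\mathcal T_B}\mathbf 1_{Y(T)}(x)$ and $X_{B,k}=\{2^k\le f_B<2^{k+1}\}$, choose $k_0\in\{0,\dots,\lceil\log_2N_{\max}\rceil\}$ with $\sum_B\int_{X_{B,k_0}}f_B\ge L_{\rm in}^{-1}M(Y)$, $L_{\rm in}=1+\lceil\log_2N_{\max}\rceil$. Put $\mu_{\rm in}=2^{k_0}$, $Y_0(T)=Y(T)\cap X_{B,k_0}$ for $T\in\mathcal T_B$. (2) Put $\omega_{BQ}=\sum_{T\in\mathcal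 T_B}|Y_0(T)\cap Q|$ for $Q\in\mathcal Q_h$ and $E^+=\{(B,Q):\omega_{BQ}>0\}$. Choose $E_1\subset E^+$ and $\omega_0>0$ with $\omega_0\le\omega_e<2\omega_0$ on $E_1$ and $\sum_{E_1}\omega_e\ge\frac{1}{2(1+\lceil\log_2(2|E^+|)\rceil)}\sum_{E^+}\omega_e$ (such a choice exists). (3) With $d_1(Q)=\#\{B:(B,Q)\in E_1\}$, choose a dyadic number $d_0$ for which the cells with $d_0\le d_1(Q)<2d_0$ carry the greatest $E_1$-weight, and put $E_2=\{(B,Q)\in E_1:d_0\le d_1(Q)<2d_0\}$. (4) Put $Z(B)=\bigcup_{Q:(B,Q)\in E_2}Q$ and $Y_1(T)=Y_0(T)\cap Z(B)$ for $T\in\mathcal T_B$ (both empty if $B$ has no $E_2$-edge). The total loss is $$\mathfrak L=L_{\rm in}\cdot2\bigl(1+\lceil\log_2(2|E^+|)\rceil\bigr)\cdot2\bigl(1+\lceil\log_2|E_1|\rceil\bigr).$$ *)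

theory Defs
  imports "HOL-Analysis.Analysis"
begin

text \<open>Families are labelled by finite sets of a type of labels; sets in \<open>\<real>\<^sup>3\<close> are
  attached to labels by functions, so equal carriers with different labels stay distinct.
  The disjoint union of the families \<open>\<T>\<^sub>B\<close> is a finite set of child labels
  together with a parent map, and \<open>\<T>\<^sub>B\<close> is a fibre of that map.\<close>

definition children :: "'t set \<Rightarrow> ('t \<Rightarrow> 'b) \<Rightarrow> 'b \<Rightarrow> 't set" where
  "children TT par B = {T \<in> TT. par T = B}"

text \<open>The closed rectangular box with centre \<open>p\<close>, half-side lengths \<open>w\<close> and
  axes the images of the coordinate axes under the orthogonal map \<open>R\<close>.\<close>

definition obox :: "real^3 \<Rightarrow> (real^3 \<Rightarrow> real^3) \<Rightarrow> real^3 \<Rightarrow> (real^3) set" where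
  "obox p R w = (\<lambda>x. p + R x) ` cbox (- w) w"

definition half_sides :: "real \<Rightarrow> real \<Rightarrow> real \<Rightarrow> real^3" where
  "half_sides a b r = vector [a / 2, b / 2, r / 2]"

definition enlarged_half_sides :: "real \<Rightarrow> real \<Rightarrow> real \<Rightarrow> real \<Rightarrow> real^3" where
  "enlarged_half_sides h a b r =
     vector [a / 2 + sqrt 3 * h, b / 2 + sqrt 3 * h, r / 2 + sqrt 3 * h]"

definition cells :: "real \<Rightarrow> (real^3) set set" where
  "cells h = {{h *\<^sub>R (k + u) | u. \<forall>i. 0 \<le> u $ i \<and> u $ i < 1} | k. \<forall>i. k $ i \<in> \<int>}"

definition shading_union :: "'t set \<Rightarrow> ('t \<Rightarrow> (real^3) set) \<Rightarrow> (real^3) set" where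
  "shading_union F Y = (\<Union>T\<in>F. Y T)"

definition multiplicity_at :: "'t set \<Rightarrow> ('t \<Rightarrow> (real^3) set) \<Rightarrow> real^3 \<Rightarrow> real" where
  "multiplicity_at F Y x = (\<Sum>T\<in>F. indicat_real (Y T) x)"

text \<open>Masses and weights take values in \<open>[0,\<infinity>]\<close>, so that \<open>M(Y) < \<infinity>\<close> can be stated.\<close>

definition mass :: "'b set \<Rightarrow> 't set \<Rightarrow> ('t \<Rightarrow> 'b) \<Rightarrow> ('t \<Rightarrow> (real^3) set) \<Rightarrow> ennreal" where
  "mass BB TT par Y = (\<Sum>B\<in>BB. \<Sum>T\<in>children TT par B. emeasure lebesgue (Y T))"

definition level_set :: "'t set \<Rightarrow> ('t \<Rightarrow> (real^3) set) \<Rightarrow> nat \<Rightarrow> (real^3) set" where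
  "level_set F Y k = {x. 2 ^ k \<le> multiplicity_at F Y x \<and> multiplicity_at F Y x < 2 ^ (k + 1)}"

definition edge_weight ::
    "'t set \<Rightarrow> ('t \<Rightarrow> 'b) \<Rightarrow> ('t \<Rightarrow> (real^3) set) \<Rightarrow> 'b \<times> (real^3) set \<Rightarrow> ennreal" where
  "edge_weight TT par Y = (\<lambda>(B, Q). \<Sum>T\<in>children TT par B. emeasure lebesgue (Y T \<inter> Q))"

definition positive_edges ::
    "'b set \<Rightarrow> 't set \<Rightarrow> ('t \<Rightarrow> 'b) \<Rightarrow> ('t \<Rightarrow> (real^3) set) \<Rightarrow> real \<Rightarrow> ('b \<times> (real^3) set) set" where
  "positive_edges BB TT par Y h = {e \<in> BB \<times> cells h. edge_weight TT par Y e > 0}"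

definition cell_degree :: "('b \<times> 'q) set \<Rightarrow> 'q \<Rightarrow> nat" where
  "cell_degree E Q = card {B. (B, Q) \<in> E}"

definition degree_class :: "('b \<times> 'q) set \<Rightarrow> real \<Rightarrow> ('b \<times> 'q) set" where
  "degree_class E d = {(B, Q) \<in> E. d \<le> real (cell_degree E Q) \<and> real (cell_degree E Q) < 2 * d}"

end

theory Submission
  imports Defs
begin

text \<open>The pointwise multiplicity bounds rest on two facts. Restricting to a level set of the
  multiplicity in a parent, or to a union of cells, removes a point from the shadings of all
  children of that parent at once, so at a point that survives, the multiplicity of these children
  is the original one. And the cells of side \<open>h\<close> are the fibres of the coordinatewise floor of \<open>x / h\<close>
  (\<open>cells_eq_floor_fibres\<close>), so a point lies in a single cell \<open>Q\<close>; it is then in \<open>Z B\<close> exactly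
  when \<open>(B, Q)\<close> is a selected edge. Since membership in a degree class depends on \<open>Q\<close> alone, the
  selected edges at \<open>Q\<close> are all the edges at \<open>Q\<close>, and their number is the cell degree, which lies
  between \<open>d0\<close> and \<open>2 * d0\<close>. Fewer than \<open>2 * d0\<close> parents, each contributing at most \<open>2 * \<mu>in\<close>, give
  the bound on the total multiplicity.

  The containment of \<open>Z B\<close> in the enlarged box holds because an edge of positive weight has a cell
  that meets the box, and a cell has diameter at most \<open>sqrt 3 * h\<close>
  (\<open>obox_near_subset_enlarged\<close>).

  For the mass bound, the mass left after restricting to the cells of a set of edges is the total
  weight of these edges (\<open>mass_restrict_to_edges\<close>). Only finitely many cells meet a bounded box, so
  the positive edges carry the whole mass of \<open>Y0\<close>. The first two selections lose the assumed
  factors. In the third, the degree of a cell is an integer between \<open>1\<close> and the number of edges, so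
  at most \<open>1 + \<lceil>log 2 |E1|\<rceil>\<close> dyadic classes occur, and the heaviest one carries at least the
  average (\<open>weight_le_heaviest_degree_class\<close>).\<close>

section \<open>Cells of the grid\<close>

text \<open>The floor description makes disjointness, measurability and finiteness of the cells
  immediate.\<close>

lemma cells_eq_floor_fibres:
  assumes "0 < h"
  shows "cells h = range (\<lambda>k::int^3. {x. \<forall>i. \<lfloor>x $ i / h\<rfloor> = k $ i})"
proof -
  have fibre: "{h *\<^sub>R (k + u) | u. \<forall>i. 0 \<le> u $ i \<and> u $ i < 1} = {x. \<forall>i. \<lfloor>x $ i / h\<rfloor> = m $ i}"
    if k: "\<And>i. k $ i = real_of_int (m $ i)" for k :: "real^3" and m :: "int^3"
  proof (intro set_eqI iffI)
    fix x assume "x \<in> {h *\<^sub>R (k + u) | u. \<forall>i. 0 \<le> u $ i \<and> u $ i < 1}"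
    then obtain u where x: "x = h *\<^sub>R (k + u)" and u: "\<And>i. 0 \<le> u $ i \<and> u $ i < 1" by auto
    have "x $ i / h = real_of_int (m $ i) + u $ i" for i using assms k by (simp add: x)
    then show "x \<in> {x. \<forall>i. \<lfloor>x $ i / h\<rfloor> = m $ i}" using u by (simp add: floor_eq_iff)
  next
    fix x assume x: "x \<in> {x. \<forall>i. \<lfloor>x $ i / h\<rfloor> = m $ i}"
    define u where "u = (1 / h) *\<^sub>R x - k"
    have "x = h *\<^sub>R (k + u)" using assms by (simp add: u_def)
    moreover have "0 \<le> u $ i \<and> u $ i < 1" for i
      using x by (simp add: u_def k floor_eq_iff) (smt (verit))
    ultimately show "x \<in> {h *\<^sub>R (k + u) | u. \<forall>i. 0 \<le> u $ i \<and> u $ i < 1}" by blast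
  qed
  show ?thesis
  proof (intro set_eqI iffI)
    fix Q assume "Q \<in> cells h"
    then obtain k :: "real^3" where k: "\<And>i. k $ i \<in> \<int>"
      and Q: "Q = {h *\<^sub>R (k + u) | u. \<forall>i. 0 \<le> u $ i \<and> u $ i < 1}"
      unfolding cells_def by auto
    have "k $ i = real_of_int ((\<chi> i. \<lfloor>k $ i\<rfloor>) $ i)" for i using k[of i] by simp
    from fibre[OF this] Q show "Q \<in> range (\<lambda>k::int^3. {x. \<forall>i. \<lfloor>x $ i / h\<rfloor> = k $ i})"
      by blast
  next
    fix Q assume "Q \<in> range (\<lambda>k::int^3. {x. \<forall>i. \<lfloor>x $ i / h\<rfloor> = k $ i})"
    then obtain m :: "int^3" where Q: "Q = {x. \<forall>i. \<lfloor>x $ i / h\<rfloor> = m $ i}" by auto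
    define k :: "real^3" where "k = (\<chi> i. real_of_int (m $ i))"
    have "Q = {h *\<^sub>R (k + u) | u. \<forall>i. 0 \<le> u $ i \<and> u $ i < 1}"
      using fibre[of k m] by (simp add: k_def Q)
    moreover have "\<forall>i. k $ i \<in> \<int>" by (simp add: k_def)
    ultimately show "Q \<in> cells h" unfolding cells_def by blast
  qed
qed

lemma cell_unique:
  assumes "0 < h" "Q \<in> cells h" "Q' \<in> cells h" "x \<in> Q" "x \<in> Q'"
  shows "Q = Q'"
  using assms by (auto simp: cells_eq_floor_fibres)

lemma ex_cell_containing:
  assumes "0 < h"
  shows "\<exists>Q\<in>cells h. x \<in> Q"
  unfolding cells_eq_floor_fibres[OF assms]
  by (rule bexI[of _ "{y. \<forall>i. \<lfloor>y $ i / h\<rfloor> = (\<chi> i. \<lfloor>x $ i / h\<rfloor>) $ i}"]) (simp, blast)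

lemma cell_measurable:
  assumes "0 < h" "Q \<in> cells h"
  shows "Q \<in> sets lebesgue"
proof -
  obtain k :: "int^3" where "Q = {x. \<forall>i. \<lfloor>x $ i / h\<rfloor> = k $ i}"
    using assms by (auto simp: cells_eq_floor_fibres)
  then have "Q = (\<Inter>i. {x. real_of_int (k $ i) \<le> x $ i / h} \<inter> {x. x $ i / h < real_of_int (k $ i) + 1})"
    by (auto simp: floor_eq_iff)
  also have "\<dots> \<in> sets borel" by measurable
  finally show ?thesis by simp
qed

lemma cell_dist_le:
  assumes "0 < h" "Q \<in> cells h" "x \<in> Q" "y \<in> Q"
  shows "norm (x - y) \<le> sqrt 3 * h"
proof -
  have "\<bar>(x - y) $ i\<bar> \<le> h" for i
  proof -
    have "\<lfloor>x $ i / h\<rfloor> = \<lfloor>y $ i / h\<rfloor>" using assms by (auto simp: cells_eq_floor_fibres)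
    then have "\<bar>x $ i / h - y $ i / h\<bar> \<le> 1" by linarith
    then have "\<bar>x $ i - y $ i\<bar> / h \<le> 1" using assms(1) by (simp flip: diff_divide_distrib)
    then show ?thesis using assms(1) by (simp add: divide_le_eq)
  qed
  then have "((x - y) $ i)\<^sup>2 \<le> h\<^sup>2" for i using assms(1) by (metis abs_le_square_iff abs_of_pos)
  then have "(\<Sum>i\<in>UNIV. ((x - y) $ i)\<^sup>2) \<le> (\<Sum>i\<in>(UNIV :: 3 set). h\<^sup>2)" by (intro sum_mono) simp
  then have "norm (x - y) \<le> sqrt (3 * h\<^sup>2)"
    by (simp add: norm_vec_def L2_set_def)
  then show ?thesis using assms(1) by (simp add: real_sqrt_mult)
qed

lemma finite_cells_meeting_bounded:
  assumes "0 < h" "bounded S"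
  shows "finite {Q \<in> cells h. Q \<inter> S \<noteq> {}}"
proof -
  obtain N where N: "\<And>x. x \<in> S \<Longrightarrow> norm x \<le> N" using assms(2) by (auto simp: bounded_iff)
  define K where "K = {\<lfloor>- N / h\<rfloor> .. \<lfloor>N / h\<rfloor>}"
  define cell where "cell = (\<lambda>g::3 \<Rightarrow> int. {x :: real^3. \<forall>i. \<lfloor>x $ i / h\<rfloor> = g i})"
  have "Q \<in> cell ` (UNIV \<rightarrow>\<^sub>E K)" if Q: "Q \<in> cells h" "Q \<inter> S \<noteq> {}" for Q
  proof -
    obtain x where x: "x \<in> Q" "x \<in> S" using Q by auto
    have "\<lfloor>x $ i / h\<rfloor> \<in> K" for i
    proof -
      have "\<bar>x $ i\<bar> \<le> N" using component_le_norm_cart[of x i] N[OF x(2)] by simp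
      then have "- N \<le> x $ i" "x $ i \<le> N" by auto
      then have "- N / h \<le> x $ i / h" "x $ i / h \<le> N / h"
        using assms(1) by (simp_all only: divide_right_mono less_imp_le)
      then show ?thesis unfolding K_def by (simp add: floor_mono)
    qed
    then have "(\<lambda>i. \<lfloor>x $ i / h\<rfloor>) \<in> UNIV \<rightarrow>\<^sub>E K" by auto
    moreover have "Q = cell (\<lambda>i. \<lfloor>x $ i / h\<rfloor>)"
      using Q(1) x(1) assms(1) by (auto simp: cells_eq_floor_fibres cell_def)
    ultimately show ?thesis by blast
  qed
  then have "{Q \<in> cells h. Q \<inter> S \<noteq> {}} \<subseteq> cell ` (UNIV \<rightarrow>\<^sub>E K)" by blast
  moreover have "finite (UNIV \<rightarrow>\<^sub>E K :: (3 \<Rightarrow> int) set)" by (rule finite_PiE) (simp_all add: K_def)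
  ultimately show ?thesis using finite_surj by blast
qed

section \<open>Boxes and their enlargements\<close>

lemma bounded_obox:
  assumes "orthogonal_transformation R"
  shows "bounded (obox p R w)"
proof -
  have "bounded (R ` cbox (- w) w)"
    using assms by (intro bounded_linear_image)
      (simp_all add: orthogonal_transformation_linear linear_conv_bounded_linear[symmetric])
  then have "bounded ((\<lambda>x. p + x) ` R ` cbox (- w) w)" by (rule bounded_translation)
  then show ?thesis by (simp add: obox_def image_image)
qed

text \<open>An orthogonal map preserves distances, so in the coordinates of the box a displacement of
  length \<open>s\<close> moves each coordinate by at most \<open>s\<close>.\<close>

lemma obox_near_subset_enlarged:
  assumes R: "orthogonal_transformation R" and y: "y \<in> obox p R w"
    and near: "norm (x - y) \<le> s" and w': "\<And>i. w $ i + s \<le> w' $ i"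
  shows "x \<in> obox p R w'"
proof -
  obtain v where v: "v \<in> cbox (- w) w" "y = p + R v" using y by (auto simp: obox_def)
  obtain u where u: "x - p = R u" using orthogonal_transformation_surj[OF R] by (metis surjD)
  have "R (u - v) = x - y"
    using orthogonal_transformation_linear[OF R] u v(2) by (simp add: linear_diff algebra_simps)
  then have "norm (u - v) \<le> s" using orthogonal_transformation_norm[OF R, of "u - v"] near by simp
  then have "\<bar>u $ i - v $ i\<bar> \<le> s" for i using component_le_norm_cart[of "u - v" i] by simp
  then have "- w' $ i \<le> u $ i \<and> u $ i \<le> w' $ i" for i
    using v(1) w'[of i] by (simp add: mem_box_cart) (smt (verit))
  then have "u \<in> cbox (- w') w'" by (simp add: mem_box_cart)
  moreover have "x = p + R u" using u by (simp add: algebra_simps)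
  ultimately show ?thesis by (auto simp: obox_def)
qed

lemma enlarged_half_sides_eq: "enlarged_half_sides h a b r $ i = half_sides a b r $ i + sqrt 3 * h"
  using exhaust_3[of i] by (auto simp: enlarged_half_sides_def half_sides_def)

lemma half_sides_ge:
  assumes "a \<le> b" "b \<le> r"
  shows "a / 2 \<le> half_sides a b r $ i"
  using exhaust_3[of i] assms by (auto simp: half_sides_def)

section \<open>Mass and edge weights\<close>

lemma finite_children: "finite TT \<Longrightarrow> finite (children TT par B)"
  by (simp add: children_def)

lemma level_set_measurable:
  assumes "finite F" "\<And>T. T \<in> F \<Longrightarrow> Y T \<in> sets lebesgue"
  shows "level_set F Y k \<in> sets lebesgue"
proof -
  have "multiplicity_at F Y \<in> borel_measurable lebesgue"
    unfolding multiplicity_at_def using assms by (intro borel_measurable_sum borel_measurable_indicator)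
  then have "{x \<in> space lebesgue. 2 ^ k \<le> multiplicity_at F Y x \<and> multiplicity_at F Y x < 2 ^ (k + 1)}
      \<in> sets lebesgue" by measurable
  then show ?thesis by (simp add: level_set_def)
qed

lemma nn_integral_multiplicity:
  assumes "\<And>T. T \<in> F \<Longrightarrow> Y T \<in> sets lebesgue" "A \<in> sets lebesgue"
  shows "(\<integral>\<^sup>+x\<in>A. ennreal (multiplicity_at F Y x) \<partial>lebesgue) = (\<Sum>T\<in>F. emeasure lebesgue (Y T \<inter> A))"
proof -
  have "(\<integral>\<^sup>+x\<in>A. ennreal (multiplicity_at F Y x) \<partial>lebesgue)
      = (\<integral>\<^sup>+x. (\<Sum>T\<in>F. indicator (Y T \<inter> A) x) \<partial>lebesgue)"
    by (simp add: multiplicity_at_def sum_ennreal[symmetric] ennreal_indicator sum_distrib_right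
        indicator_inter_arith)
  also have "\<dots> = (\<Sum>T\<in>F. \<integral>\<^sup>+x. indicator (Y T \<inter> A) x \<partial>lebesgue)"
    using assms by (intro nn_integral_sum) auto
  also have "\<dots> = (\<Sum>T\<in>F. emeasure lebesgue (Y T \<inter> A))"
    using assms by (intro sum.cong refl nn_integral_indicator) auto
  finally show ?thesis .
qed

text \<open>The cells of the edges at one parent are disjoint, so the measure of a shading restricted to
  their union is additive; exchanging the sums over children and cells gives edge weights.\<close>

lemma mass_restrict_to_edges:
  assumes h: "0 < h" and E: "finite E" "E \<subseteq> BB \<times> cells h"
    and BB: "finite BB" and meas: "\<And>T. T \<in> TT \<Longrightarrow> A T \<in> sets lebesgue"
  shows "mass BB TT par (\<lambda>T. A T \<inter> \<Union>{Q. (par T, Q) \<in> E}) = (\<Sum>e\<in>E. edge_weight TT par A e)"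
proof -
  define EQ where "EQ B = {Q. (B, Q) \<in> E}" for B
  have EQ: "finite (EQ B)" "EQ B \<subseteq> cells h" for B
    using finite_subset[of "EQ B" "snd ` E"] E by (force simp: EQ_def)+
  have split: "emeasure lebesgue (A T \<inter> \<Union>(EQ B)) = (\<Sum>Q\<in>EQ B. emeasure lebesgue (A T \<inter> Q))"
    if "T \<in> TT" for T B
  proof -
    have "disjoint_family_on (\<lambda>Q. A T \<inter> Q) (EQ B)"
      using cell_unique[OF h] EQ(2)[of B] unfolding disjoint_family_on_def by blast
    then have "(\<Sum>Q\<in>EQ B. emeasure lebesgue (A T \<inter> Q)) = emeasure lebesgue (\<Union>Q\<in>EQ B. A T \<inter> Q)"
      using EQ[of B] cell_measurable[OF h] meas[OF that] by (intro sum_emeasure) auto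
    also have "(\<Union>Q\<in>EQ B. A T \<inter> Q) = A T \<inter> \<Union>(EQ B)" by auto
    finally show ?thesis by simp
  qed
  have "mass BB TT par (\<lambda>T. A T \<inter> \<Union>{Q. (par T, Q) \<in> E})
      = (\<Sum>B\<in>BB. \<Sum>T\<in>children TT par B. \<Sum>Q\<in>EQ B. emeasure lebesgue (A T \<inter> Q))"
    unfolding mass_def by (intro sum.cong refl) (simp add: children_def split flip: EQ_def)
  also have "\<dots> = (\<Sum>B\<in>BB. \<Sum>Q\<in>EQ B. edge_weight TT par A (B, Q))"
    unfolding edge_weight_def prod.case by (intro sum.cong refl sum.swap)
  also have "\<dots> = (\<Sum>e\<in>Sigma BB EQ. edge_weight TT par A e)"
    using BB EQ by (subst sum.Sigma) auto
  also have "Sigma BB EQ = E" using E(2) by (auto simp: EQ_def)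
  finally show ?thesis .
qed

lemma positive_edge_meets:
  assumes "(B, Q) \<in> positive_edges BB TT par A h"
  obtains T where "T \<in> children TT par B" "A T \<inter> Q \<noteq> {}"
proof (rule ccontr)
  assume "\<not> thesis"
  then have "\<And>T. T \<in> children TT par B \<Longrightarrow> A T \<inter> Q = {}" using that by blast
  then have "edge_weight TT par A (B, Q) = 0" by (simp add: edge_weight_def)
  then show False using assms by (simp add: positive_edges_def)
qed

lemma positive_edges_subset_meeting:
  assumes A: "\<And>T. T \<in> TT \<Longrightarrow> A T \<subseteq> S (par T)"
  shows "positive_edges BB TT par A h \<subseteq> (SIGMA B:BB. {Q \<in> cells h. Q \<inter> S B \<noteq> {}})"
proof
  fix e assume e: "e \<in> positive_edges BB TT par A h"
  obtain B Q where BQ: "e = (B, Q)" by (cases e)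
  obtain T where "T \<in> children TT par B" "A T \<inter> Q \<noteq> {}"
    using positive_edge_meets e BQ by metis
  then have "Q \<inter> S B \<noteq> {}" using A[of T] by (auto simp: children_def)
  then show "e \<in> (SIGMA B:BB. {Q \<in> cells h. Q \<inter> S B \<noteq> {}})"
    using e BQ by (auto simp: positive_edges_def)
qed

lemma finite_edges_meeting:
  assumes h: "0 < h" and BB: "finite BB" and S: "\<And>B. B \<in> BB \<Longrightarrow> bounded (S B)"
  shows "finite (SIGMA B:BB. {Q \<in> cells h. Q \<inter> S B \<noteq> {}})"
  by (rule finite_SigmaI[OF BB finite_cells_meeting_bounded[OF h S]])

text \<open>The finitely many cells that meet the bounded sets \<open>S B\<close> cover the shadings, and those among
  them that are not positive edges have weight zero.\<close>

lemma mass_eq_positive_edges: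
  assumes h: "0 < h" and BB: "finite BB"
    and A: "\<And>T. T \<in> TT \<Longrightarrow> A T \<subseteq> S (par T)" and S: "\<And>B. B \<in> BB \<Longrightarrow> bounded (S B)"
    and meas: "\<And>T. T \<in> TT \<Longrightarrow> A T \<in> sets lebesgue"
  shows "mass BB TT par A = (\<Sum>e\<in>positive_edges BB TT par A h. edge_weight TT par A e)"
proof -
  define E where "E = Sigma BB (\<lambda>B. {Q \<in> cells h. Q \<inter> S B \<noteq> {}})"
  have fin: "finite E" unfolding E_def using h BB S by (rule finite_edges_meeting)
  have covered: "A T \<inter> \<Union>{Q. (par T, Q) \<in> E} = A T" if "T \<in> TT" "par T \<in> BB" for T
    using A[OF that(1)] that(2) ex_cell_containing[OF h] by (fastforce simp: E_def)
  have "mass BB TT par A = mass BB TT par (\<lambda>T. A T \<inter> \<Union>{Q. (par T, Q) \<in> E})"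
    unfolding mass_def by (intro sum.cong refl arg_cong[of _ _ "emeasure lebesgue"])
      (simp add: children_def covered)
  also have "\<dots> = (\<Sum>e\<in>E. edge_weight TT par A e)"
    by (rule mass_restrict_to_edges[OF h fin _ BB meas]) (auto simp: E_def)
  also have "\<dots> = (\<Sum>e\<in>positive_edges BB TT par A h. edge_weight TT par A e)"
  proof (rule sum.mono_neutral_right[OF fin])
    show "positive_edges BB TT par A h \<subseteq> E"
      unfolding E_def using A by (rule positive_edges_subset_meeting)
    show "\<forall>e\<in>E - positive_edges BB TT par A h. edge_weight TT par A e = 0"
      by (auto simp: E_def positive_edges_def zero_less_iff_neq_zero)
  qed
  finally show ?thesis .
qed

section \<open>Dyadic degree classes\<close>

lemma ceiling_log2_nat_nonneg: "0 \<le> \<lceil>log 2 (real n)\<rceil>"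
proof -
  have "0 \<le> log 2 (real n)" by (cases "n = 0") (simp add: log_def, simp)
  then show ?thesis by linarith
qed

text \<open>Sorting the edges by the integer part of the binary logarithm of their cell degree puts them
  into the classes with exponents between \<open>0\<close> and \<open>\<lceil>log 2 |E|\<rceil>\<close>.\<close>

lemma weight_le_heaviest_degree_class:
  fixes w :: "'b \<times> 'q \<Rightarrow> ennreal"
  assumes E: "finite E"
    and m: "\<And>j::int. (\<Sum>e\<in>degree_class E (2 powi j). w e) \<le> m"
  shows "(\<Sum>e\<in>E. w e) \<le> ennreal (1 + of_int \<lceil>log 2 (real (card E))\<rceil>) * m"
proof -
  define J where "J = {0..\<lceil>log 2 (real (card E))\<rceil>}"
  define g where "g = (\<lambda>e::'b \<times> 'q. \<lfloor>log 2 (real (cell_degree E (snd e)))\<rfloor>)"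
  have deg: "1 \<le> cell_degree E (snd e) \<and> cell_degree E (snd e) \<le> card E" if "e \<in> E" for e
  proof -
    have "finite {B. (B, snd e) \<in> E}"
      by (rule finite_subset[of _ "fst ` E"]) (use E in force)+
    moreover have "fst e \<in> {B. (B, snd e) \<in> E}" using that by simp
    ultimately have "1 \<le> cell_degree E (snd e)"
      unfolding cell_degree_def by (metis One_nat_def Suc_leI card_gt_0_iff empty_iff)
    moreover have "cell_degree E (snd e) \<le> card E"
      unfolding cell_degree_def
      by (rule card_inj_on_le[of "\<lambda>B. (B, snd e)"]) (use E in \<open>auto simp: inj_on_def\<close>)
    ultimately show ?thesis by simp
  qed
  have gJ: "g ` E \<subseteq> J"
  proof
    fix j assume "j \<in> g ` E"
    then obtain e where e: "e \<in> E" "j = g e" by auto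
    have "0 \<le> log 2 (real (cell_degree E (snd e)))"
      "log 2 (real (cell_degree E (snd e))) \<le> log 2 (real (card E))"
      using deg[OF e(1)] by auto
    then show "j \<in> J" unfolding J_def e(2) g_def by simp linarith
  qed
  have in_class: "{e \<in> E. g e = j} \<subseteq> degree_class E (2 powi j)" for j
  proof
    fix e assume "e \<in> {e \<in> E. g e = j}"
    then have e: "e \<in> E" and j: "\<lfloor>log 2 (real (cell_degree E (snd e)))\<rfloor> = j" by (auto simp: g_def)
    have pos: "0 < real (cell_degree E (snd e))" using deg[OF e] by simp
    have "2 powr j \<le> real (cell_degree E (snd e))" "real (cell_degree E (snd e)) < 2 powr (j + 1)"
      using floor_log_eq_powr_iff[OF pos, of 2 j] j by auto
    then show "e \<in> degree_class E (2 powi j)"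
      using e by (cases e) (simp add: degree_class_def powr_real_of_int' powr_add mult.commute)
  qed
  have "(\<Sum>e\<in>E. w e) = (\<Sum>j\<in>J. \<Sum>e\<in>{e \<in> E. g e = j}. w e)"
    using E gJ by (intro sum.group[symmetric]) (auto simp: J_def)
  also have "\<dots> \<le> (\<Sum>j\<in>J. m)"
  proof (rule sum_mono)
    fix j
    have "finite (degree_class E (2 powi j))"
      by (rule finite_subset[OF _ E]) (auto simp: degree_class_def)
    then have "(\<Sum>e\<in>{e \<in> E. g e = j}. w e) \<le> (\<Sum>e\<in>degree_class E (2 powi j). w e)"
      using in_class by (intro sum_mono2) auto
    then show "(\<Sum>e\<in>{e \<in> E. g e = j}. w e) \<le> m" using m order_trans by blast
  qed
  also have "\<dots> = ennreal (real (card J)) * m" by (simp add: ennreal_of_nat_eq_real_of_nat)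
  also have "real (card J) = 1 + of_int \<lceil>log 2 (real (card E))\<rceil>"
    using ceiling_log2_nat_nonneg[of "card E"] by (simp add: J_def)
  finally show ?thesis .
qed

lemma ennreal_inverse_mult_le:
  assumes "x \<le> ennreal c * y" "1 \<le> c"
  shows "ennreal (1 / (2 * c)) * x \<le> y"
proof -
  have "ennreal (1 / (2 * c)) * x \<le> ennreal (1 / (2 * c)) * (ennreal c * y)"
    using assms(1) by (rule mult_left_mono) simp
  also have "\<dots> = ennreal (1 / 2) * y"
    using assms(2) by (simp add: mult.assoc[symmetric] ennreal_mult[symmetric])
  also have "\<dots> \<le> 1 * y"
  proof (rule mult_right_mono)
    have "ennreal (1 / 2) \<le> ennreal 1" by (rule ennreal_leI) simp
    then show "ennreal (1 / 2) \<le> 1" by simp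
  qed simp
  finally show ?thesis by simp
qed

text \<open>A degree class contains either all edges at a cell or none, so over a point of a selected
  cell the number of selected parents is the degree of the cell.\<close>

lemma parents_over_point_eq_cell_degree:
  assumes h: "0 < h" and BB: "finite BB" and E: "E \<subseteq> BB \<times> cells h"
    and Q: "(B, Q) \<in> degree_class E d" and x: "x \<in> Q"
  shows "(\<Sum>B\<in>BB. indicat_real (\<Union>{Q. (B, Q) \<in> degree_class E d}) x) = real (cell_degree E Q)"
proof -
  have "x \<in> \<Union>{Q. (B', Q) \<in> degree_class E d} \<longleftrightarrow> (B', Q) \<in> E" for B'
  proof
    assume "x \<in> \<Union>{Q. (B', Q) \<in> degree_class E d}"
    then obtain Q' where Q': "(B', Q') \<in> degree_class E d" "x \<in> Q'" by auto
    then have "Q' = Q"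
      using Q x E by (intro cell_unique[OF h]) (auto simp: degree_class_def)
    then show "(B', Q) \<in> E" using Q' by (simp add: degree_class_def)
  next
    assume "(B', Q) \<in> E"
    then have "(B', Q) \<in> degree_class E d" using Q by (simp add: degree_class_def)
    then show "x \<in> \<Union>{Q. (B', Q) \<in> degree_class E d}" using x by auto
  qed
  then have "(\<Sum>B\<in>BB. indicat_real (\<Union>{Q. (B, Q) \<in> degree_class E d}) x)
      = (\<Sum>B\<in>BB. if (B, Q) \<in> E then 1 else 0)"
    by (intro sum.cong refl) (simp add: indicator_def)
  also have "\<dots> = real (card (BB \<inter> {B. (B, Q) \<in> E}))" using BB by (simp add: sum.If_cases)
  also have "BB \<inter> {B. (B, Q) \<in> E} = {B. (B, Q) \<in> E}" using E by auto
  finally show ?thesis by (simp add: cell_degree_def)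
qed

lemma multiplicity_at_parents:
  assumes "finite BB" "finite TT" "\<And>T. T \<in> TT \<Longrightarrow> par T \<in> BB"
  shows "multiplicity_at TT Y x = (\<Sum>B\<in>BB. multiplicity_at (children TT par B) Y x)"
  unfolding multiplicity_at_def children_def
  using assms by (intro sum.group[symmetric]) auto

section \<open>The cellular joint construction\<close>

theorem theorem4p2:
  fixes a b r c0 h :: real
    and BB :: "'b set" and TT :: "'t set" and par :: "'t \<Rightarrow> 'b"
    and centre :: "'b \<Rightarrow> real^3" and rot :: "'b \<Rightarrow> real^3 \<Rightarrow> real^3"
    and Bsharp Btilde :: "'b \<Rightarrow> (real^3) set"
    and carrier Y Y0 Y1 :: "'t \<Rightarrow> (real^3) set"
    and Nmax k0 :: nat and Lin \<mu>in \<omega>0 d0 L :: real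
    and \<omega> :: "'b \<times> (real^3) set \<Rightarrow> ennreal"
    and Eplus E1 E2 :: "('b \<times> (real^3) set) set"
    and Z :: "'b \<Rightarrow> (real^3) set"
  assumes scales: "0 < a" "a \<le> b" "b \<le> r" "0 < c0" "c0 \<le> 1 / 10 ^ 3" "h = c0 * a"
    and parents: "finite BB" "BB \<noteq> {}"
    and orient: "\<And>B. B \<in> BB \<Longrightarrow> orthogonal_transformation (rot B)"
    and Bsharp: "\<And>B. B \<in> BB \<Longrightarrow> Bsharp B = obox (centre B) (rot B) (half_sides a b r)"
    and Btilde: "\<And>B. B \<in> BB \<Longrightarrow>
        Btilde B = obox (centre B) (rot B) (enlarged_half_sides h a b r)"
    and TT: "finite TT" "\<And>T. T \<in> TT \<Longrightarrow> par T \<in> BB"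
    and carrier: "\<And>T. T \<in> TT \<Longrightarrow> carrier T \<subseteq> Bsharp (par T)"
    and shading: "\<And>T. T \<in> TT \<Longrightarrow> Y T \<subseteq> carrier T"
        "\<And>T. T \<in> TT \<Longrightarrow> Y T \<in> sets lebesgue"
    and mass: "0 < mass BB TT par Y" "mass BB TT par Y < \<infinity>"
    and Nmax: "Nmax = Max ((\<lambda>B. card (children TT par B)) ` BB)"
    and Lin: "Lin = 1 + of_int \<lceil>log 2 (real Nmax)\<rceil>"
    and k0: "int k0 \<le> \<lceil>log 2 (real Nmax)\<rceil>"
        "(\<Sum>B\<in>BB. \<integral>\<^sup>+x\<in>level_set (children TT par B) Y k0.
             ennreal (multiplicity_at (children TT par B) Y x) \<partial>lebesgue)
           \<ge> ennreal (1 / Lin) * mass BB TT par Y"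
    and \<mu>in: "\<mu>in = 2 ^ k0"
    and Y0: "\<And>T. T \<in> TT \<Longrightarrow> Y0 T = Y T \<inter> level_set (children TT par (par T)) Y k0"
    and \<omega>: "\<omega> = edge_weight TT par Y0"
    and Eplus: "Eplus = positive_edges BB TT par Y0 h"
    and E1: "E1 \<subseteq> Eplus" "0 < \<omega>0"
        "\<And>e. e \<in> E1 \<Longrightarrow> ennreal \<omega>0 \<le> \<omega> e \<and> \<omega> e < ennreal (2 * \<omega>0)"
        "(\<Sum>e\<in>E1. \<omega> e)
           \<ge> ennreal (1 / (2 * (1 + of_int \<lceil>log 2 (2 * real (card Eplus))\<rceil>))) * (\<Sum>e\<in>Eplus. \<omega> e)"
    and d0: "\<exists>j::int. d0 = 2 powi j"
        "\<And>j::int. (\<Sum>e\<in>degree_class E1 (2 powi j). \<omega> e) \<le> (\<Sum>e\<in>degree_class E1 d0. \<omega> e)"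
    and E2: "E2 = degree_class E1 d0"
    and Z: "\<And>B. B \<in> BB \<Longrightarrow> Z B = \<Union>{Q. (B, Q) \<in> E2}"
    and Y1: "\<And>T. T \<in> TT \<Longrightarrow> Y1 T = Y0 T \<inter> Z (par T)"
    and L: "L = Lin * (2 * (1 + of_int \<lceil>log 2 (2 * real (card Eplus))\<rceil>))
                    * (2 * (1 + of_int \<lceil>log 2 (real (card E1))\<rceil>))"
  shows "(mass BB TT par Y1 \<ge> ennreal (1 / L) * mass BB TT par Y)
    \<and> (\<forall>B\<in>BB. \<forall>T\<in>children TT par B. \<forall>x\<in>Y1 T. x \<in> Z B)
    \<and> (\<forall>B\<in>BB. \<forall>x\<in>shading_union (children TT par B) Y1.
        \<mu>in \<le> multiplicity_at (children TT par B) Y1 x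
        \<and> multiplicity_at (children TT par B) Y1 x < 2 * \<mu>in)
    \<and> (\<forall>x\<in>(\<Union>B\<in>BB. Z B).
        d0 \<le> (\<Sum>B\<in>BB. indicat_real (Z B) x) \<and> (\<Sum>B\<in>BB. indicat_real (Z B) x) < 2 * d0)
    \<and> (\<forall>x\<in>shading_union TT Y1. multiplicity_at TT Y1 x < 4 * \<mu>in * d0)
    \<and> (\<forall>B\<in>BB. Z B \<subseteq> Btilde B)
    \<and> (\<forall>i. half_sides a b r $ i \<le> enlarged_half_sides h a b r $ i
        \<and> enlarged_half_sides h a b r $ i \<le> (1 + 2 * sqrt 3 * c0) * half_sides a b r $ i)"
proof -
  have h: "0 < h" using scales by simp
  have E1_edges: "E1 \<subseteq> BB \<times> cells h" using E1(1) Eplus by (auto simp: positive_edges_def)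
  have E2_E1: "E2 \<subseteq> E1" using E2 by (auto simp: degree_class_def)
  have Y0_box: "Y0 T \<subseteq> Bsharp (par T)" if "T \<in> TT" for T
    using Y0[OF that] shading(1)[OF that] carrier[OF that] by auto
  have box_bounded: "bounded (Bsharp B)" if "B \<in> BB" for B
    using Bsharp[OF that] bounded_obox[OF orient[OF that]] by simp
  have level_meas: "level_set (children TT par B) Y k0 \<in> sets lebesgue" for B
    using finite_children[OF TT(1)] shading(2)
    by (intro level_set_measurable) (auto simp: children_def)
  have Y0_meas: "Y0 T \<in> sets lebesgue" if "T \<in> TT" for T
    using Y0[OF that] shading(2)[OF that] level_meas by auto
  have finE: "finite Eplus" unfolding Eplus
    by (rule finite_subset[OF positive_edges_subset_meeting[where S = Bsharp, OF Y0_box]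
          finite_edges_meeting[OF h parents(1) box_bounded]])
  then have finE1: "finite E1" using E1(1) finite_subset by blast
  then have finE2: "finite E2" using E2_E1 finite_subset by blast

  have P1: "mass BB TT par Y1 \<ge> ennreal (1 / L) * mass BB TT par Y"
  proof -
    define l2 l3 where "l2 = (2 * (1 + of_int \<lceil>log 2 (2 * real (card Eplus))\<rceil>) :: real)"
      and "l3 = (1 + of_int \<lceil>log 2 (real (card E1))\<rceil> :: real)"
    have l1: "1 \<le> Lin" using Lin ceiling_log2_nat_nonneg[of Nmax] by simp
    have l2: "1 \<le> l2" using ceiling_log2_nat_nonneg[of "2 * card Eplus"] by (simp add: l2_def)
    have l3: "1 \<le> l3" using ceiling_log2_nat_nonneg[of "card E1"] by (simp add: l3_def)
    have "(\<Sum>B\<in>BB. \<integral>\<^sup>+x\<in>level_set (children TT par B) Y k0.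
             ennreal (multiplicity_at (children TT par B) Y x) \<partial>lebesgue) = mass BB TT par Y0"
      unfolding mass_def
    proof (intro sum.cong refl)
      fix B
      have "(\<integral>\<^sup>+x\<in>level_set (children TT par B) Y k0.
             ennreal (multiplicity_at (children TT par B) Y x) \<partial>lebesgue)
          = (\<Sum>T\<in>children TT par B. emeasure lebesgue (Y T \<inter> level_set (children TT par B) Y k0))"
        using shading(2) level_meas by (intro nn_integral_multiplicity) (auto simp: children_def)
      also have "\<dots> = (\<Sum>T\<in>children TT par B. emeasure lebesgue (Y0 T))"
        using Y0 by (intro sum.cong refl) (auto simp: children_def)
      finally show "(\<integral>\<^sup>+x\<in>level_set (children TT par B) Y k0.
             ennreal (multiplicity_at (children TT par B) Y x) \<partial>lebesgue)
          = (\<Sum>T\<in>children TT par B. emeasure lebesgue (Y0 T))" .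
    qed
    then have step1: "ennreal (1 / Lin) * mass BB TT par Y \<le> mass BB TT par Y0" using k0(2) by simp
    have Y0_edges: "mass BB TT par Y0 = (\<Sum>e\<in>Eplus. \<omega> e)" unfolding Eplus \<omega>
      using h parents(1) Y0_box box_bounded Y0_meas by (rule mass_eq_positive_edges)
    have step2: "ennreal (1 / l2) * (\<Sum>e\<in>Eplus. \<omega> e) \<le> (\<Sum>e\<in>E1. \<omega> e)"
      using E1(4) by (simp add: l2_def)
    have "(\<Sum>e\<in>E1. \<omega> e) \<le> ennreal l3 * (\<Sum>e\<in>E2. \<omega> e)"
      unfolding l3_def E2 using finE1 d0(2) by (rule weight_le_heaviest_degree_class)
    then have step3: "ennreal (1 / (2 * l3)) * (\<Sum>e\<in>E1. \<omega> e) \<le> (\<Sum>e\<in>E2. \<omega> e)"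
      using l3 by (rule ennreal_inverse_mult_le)
    have "mass BB TT par Y1 = mass BB TT par (\<lambda>T. Y0 T \<inter> \<Union>{Q. (par T, Q) \<in> E2})"
      unfolding mass_def using Y1 Z TT(2)
      by (intro sum.cong refl arg_cong[of _ _ "emeasure lebesgue"]) (auto simp: children_def)
    also have "\<dots> = (\<Sum>e\<in>E2. \<omega> e)" unfolding \<omega>
      using E1_edges E2_E1 Y0_meas by (intro mass_restrict_to_edges[OF h finE2 _ parents(1)]) auto
    finally have Y1_edges: "mass BB TT par Y1 = (\<Sum>e\<in>E2. \<omega> e)" .
    \<comment> \<open>\<open>ennreal\<close> sends negative reals to \<open>0\<close>; the factors are at least \<open>1\<close>, so it is
      multiplicative on their reciprocals.\<close>
    have "ennreal (1 / L) = ennreal (1 / (2 * l3)) * (ennreal (1 / l2) * ennreal (1 / Lin))"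
      using l1 l2 l3 unfolding L l2_def[symmetric] l3_def[symmetric]
      by (simp add: ennreal_mult[symmetric] mult_ac)
    then have "ennreal (1 / L) * mass BB TT par Y
        = ennreal (1 / (2 * l3)) * (ennreal (1 / l2) * (ennreal (1 / Lin) * mass BB TT par Y))"
      by (simp add: mult.assoc)
    also have "\<dots> \<le> ennreal (1 / (2 * l3)) * (ennreal (1 / l2) * (\<Sum>e\<in>Eplus. \<omega> e))"
      using step1 Y0_edges by (intro mult_left_mono) auto
    also have "\<dots> \<le> ennreal (1 / (2 * l3)) * (\<Sum>e\<in>E1. \<omega> e)"
      using step2 by (intro mult_left_mono) auto
    also have "\<dots> \<le> mass BB TT par Y1" using step3 Y1_edges by simp
    finally show ?thesis .
  qed

  have P2: "\<forall>B\<in>BB. \<forall>T\<in>children TT par B. \<forall>x\<in>Y1 T. x \<in> Z B"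
    using Y1 by (auto simp: children_def)

  have P3: "\<mu>in \<le> multiplicity_at (children TT par B) Y1 x
        \<and> multiplicity_at (children TT par B) Y1 x < 2 * \<mu>in"
    if x: "x \<in> shading_union (children TT par B) Y1" for B x
  proof -
    have xL: "x \<in> level_set (children TT par B) Y k0" and xZ: "x \<in> Z B"
      using x Y1 Y0 by (auto simp: shading_union_def children_def)
    have "multiplicity_at (children TT par B) Y1 x = multiplicity_at (children TT par B) Y x"
      unfolding multiplicity_at_def
    proof (rule sum.cong[OF refl])
      fix T assume "T \<in> children TT par B"
      then have "Y1 T = Y T \<inter> level_set (children TT par B) Y k0 \<inter> Z B"
        using Y1 Y0 by (auto simp: children_def)
      then show "indicat_real (Y1 T) x = indicat_real (Y T) x"
        using xL xZ by (simp add: indicator_def)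
    qed
    then show ?thesis using xL by (simp add: level_set_def \<mu>in)
  qed

  have P4: "d0 \<le> (\<Sum>B\<in>BB. indicat_real (Z B) x) \<and> (\<Sum>B\<in>BB. indicat_real (Z B) x) < 2 * d0"
    if x: "x \<in> (\<Union>B\<in>BB. Z B)" for x
  proof -
    obtain B Q where BQ: "(B, Q) \<in> degree_class E1 d0" "x \<in> Q" using x Z E2 by auto
    have "(\<Sum>B\<in>BB. indicat_real (Z B) x) = real (cell_degree E1 Q)"
      using parents_over_point_eq_cell_degree[OF h parents(1) E1_edges BQ] by (simp add: Z E2)
    then show ?thesis using BQ(1) by (simp add: degree_class_def)
  qed

  have P5: "multiplicity_at TT Y1 x < 4 * \<mu>in * d0" if x: "x \<in> shading_union TT Y1" for x
  proof -
    have \<mu>pos: "0 < \<mu>in" by (simp add: \<mu>in)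
    have xZ: "x \<in> (\<Union>B\<in>BB. Z B)" using x Y1 TT(2) by (auto simp: shading_union_def)
    have "multiplicity_at TT Y1 x = (\<Sum>B\<in>BB. multiplicity_at (children TT par B) Y1 x)"
      by (rule multiplicity_at_parents[OF parents(1) TT])
    also have "\<dots> \<le> (\<Sum>B\<in>BB. 2 * \<mu>in * indicat_real (Z B) x)"
    proof (rule sum_mono)
      fix B assume "B \<in> BB"
      show "multiplicity_at (children TT par B) Y1 x \<le> 2 * \<mu>in * indicat_real (Z B) x"
      proof (cases "x \<in> shading_union (children TT par B) Y1")
        case True
        then have "x \<in> Z B" using P2 \<open>B \<in> BB\<close> by (auto simp: shading_union_def)
        then show ?thesis using P3[OF True] by simp
      next
        case False
        then have "multiplicity_at (children TT par B) Y1 x = 0"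
          by (auto simp: multiplicity_at_def shading_union_def indicator_def intro!: sum.neutral)
        then show ?thesis using \<mu>pos by simp
      qed
    qed
    also have "\<dots> = 2 * \<mu>in * (\<Sum>B\<in>BB. indicat_real (Z B) x)" by (simp add: sum_distrib_left)
    also have "\<dots> < 2 * \<mu>in * (2 * d0)" using P4[OF xZ] \<mu>pos by (intro mult_strict_left_mono) auto
    finally show ?thesis by simp
  qed

  have contained: "Z B \<subseteq> Btilde B" if B: "B \<in> BB" for B
  proof
    fix x assume "x \<in> Z B"
    then obtain Q where Q: "(B, Q) \<in> E2" "x \<in> Q" using Z[OF B] by auto
    then have pos: "(B, Q) \<in> positive_edges BB TT par Y0 h" using E2_E1 E1(1) Eplus by auto
    then obtain T where "T \<in> children TT par B" "Y0 T \<inter> Q \<noteq> {}" by (rule positive_edge_meets)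
    then obtain y where y: "y \<in> Q" "y \<in> Bsharp B" using Y0_box[of T] by (auto simp: children_def)
    have "norm (x - y) \<le> sqrt 3 * h"
      using cell_dist_le[OF h _ Q(2) y(1)] pos by (simp add: positive_edges_def)
    then show "x \<in> Btilde B"
      using obox_near_subset_enlarged[OF orient[OF B]] y(2)
      by (simp add: Bsharp[OF B] Btilde[OF B] enlarged_half_sides_eq)
  qed

  have sides: "half_sides a b r $ i \<le> enlarged_half_sides h a b r $ i
        \<and> enlarged_half_sides h a b r $ i \<le> (1 + 2 * sqrt 3 * c0) * half_sides a b r $ i" for i
  proof -
    have "2 * sqrt 3 * c0 * (a / 2) \<le> 2 * sqrt 3 * c0 * half_sides a b r $ i"
      using half_sides_ge[OF scales(2,3)] scales(4) by (intro mult_left_mono) auto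
    moreover have "0 \<le> sqrt 3 * h" using h by simp
    ultimately show ?thesis by (simp add: enlarged_half_sides_eq scales(6) algebra_simps)
  qed

  show ?thesis using P1 P2 P3 P4 P5 contained sides by blast
qed

end
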